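(* Let $A$ and $B$ be (complex) C$^*$-algebras and let $\Delta : A\to B$ be a weak-2-local symmetric map, that is, a map (not assumed linear nor continuous) such that for every $a,b\in A$ and every $\phi\in B^{*}$ there exists a symmetric linear map $T_{a,b,\phi}: A\to B$ (depending on $a$, $b$ and $\phi$) satisfying $\phi(\Delta(a)) = \phi(T_{a,b,\phi}(a))$ and $\phi(\Delta(b)) = \phi(T_{a,b,\phi}(b))$. Then $\Delta$ is linear.
   Context: $B^*$ denotes the Banach dual of $B$. A map $T:A\to B$ between C$^*$-algebras is called symmetric if $T(a^* )=T(a)^*$ for all $a\in A$. The symmetric linear maps $T_{a,b,\phi}$ are complex-linear and are not required to be continuous. *)

theory Defs
  imports "HOL-Analysis.Analysis"
begin

text \<open>
  The library provides only real Banach spaces and algebras, so complex scalars are added to them.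
  The real structure is tied to the complex one by \<open>scaleC_of_real\<close>; in particular it gives
  \<open>scaleC 1 x = x\<close>.
\<close>

class complex_banach = banach +
  fixes scaleC :: "complex \<Rightarrow> 'a \<Rightarrow> 'a"  (infixr "*\<^sub>C" 75)
  assumes scaleC_add_right: "c *\<^sub>C (x + y) = c *\<^sub>C x + c *\<^sub>C y"
    and scaleC_add_left: "(c + d) *\<^sub>C x = c *\<^sub>C x + d *\<^sub>C x"
    and scaleC_scaleC: "c *\<^sub>C d *\<^sub>C x = (c * d) *\<^sub>C x"
    and scaleC_of_real: "complex_of_real r *\<^sub>C x = r *\<^sub>R x"
    and norm_scaleC: "norm (c *\<^sub>C x) = cmod c * norm x"

text \<open>Algebras are not assumed to be unital, and the zero algebra is allowed.\<close>

class cstar_algebra = complex_banach + real_normed_algebra +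
  fixes star :: "'a \<Rightarrow> 'a"
  assumes mult_scaleC_left: "(c *\<^sub>C x) * y = c *\<^sub>C (x * y)"
    and mult_scaleC_right: "x * (c *\<^sub>C y) = c *\<^sub>C (x * y)"
    and star_add: "star (x + y) = star x + star y"
    and star_scaleC: "star (c *\<^sub>C x) = cnj c *\<^sub>C star x"
    and star_mult: "star (x * y) = star y * star x"
    and star_star: "star (star x) = x"
    and norm_star_mult_self: "norm (star x * x) = (norm x)\<^sup>2"

instantiation complex :: cstar_algebra
begin

definition scaleC_complex :: "complex \<Rightarrow> complex \<Rightarrow> complex"
  where "scaleC_complex = (*)"

definition star_complex :: "complex \<Rightarrow> complex"
  where "star_complex = cnj"

instance
  by standard
    (simp_all add: scaleC_complex_def star_complex_def algebra_simps norm_mult power2_eq_square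
      scaleR_conv_of_real)

end

lemma vector_space_scaleC: "vector_space (scaleC :: complex \<Rightarrow> 'a::complex_banach \<Rightarrow> 'a)"
proof
  show "1 *\<^sub>C x = x" for x :: 'a
    using scaleC_of_real[of 1 x] by simp
qed (simp_all add: scaleC_add_right scaleC_add_left scaleC_scaleC)

text \<open>The library's unqualified \<open>linear\<close> is real-linearity, hence a separate name.\<close>

abbreviation clinear :: "('a::complex_banach \<Rightarrow> 'b::complex_banach) \<Rightarrow> bool"
  where "clinear \<equiv> Vector_Spaces.linear scaleC scaleC"

lemma clinear_iff:
  "clinear f \<longleftrightarrow> (\<forall>x y. f (x + y) = f x + f y) \<and> (\<forall>c x. f (c *\<^sub>C x) = c *\<^sub>C f x)"
  by (simp add: Vector_Spaces.linear_iff vector_space_scaleC)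

definition dual :: "('b::complex_banach \<Rightarrow> complex) set"
  where "dual = {\<phi>. clinear \<phi> \<and> bounded_linear \<phi>}"

definition symmetric_map :: "('a::cstar_algebra \<Rightarrow> 'b::cstar_algebra) \<Rightarrow> bool"
  where "symmetric_map T \<longleftrightarrow> (\<forall>a. T (star a) = star (T a))"

definition weak_2_local_symmetric :: "('a::cstar_algebra \<Rightarrow> 'b::cstar_algebra) \<Rightarrow> bool"
  where "weak_2_local_symmetric \<Delta> \<longleftrightarrow>
    (\<forall>a b. \<forall>\<phi>\<in>dual. \<exists>T. clinear T \<and> symmetric_map T \<and>
      \<phi> (\<Delta> a) = \<phi> (T a) \<and> \<phi> (\<Delta> b) = \<phi> (T b))"

end

theory Submission
  imports Defs
begin

text \<open>
  Evaluating at hermitian functionals, which separate points by Hahn--Banach, turns the weak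
  condition at \<open>a\<close> and \<open>a + star a\<close> into \<open>\<Delta> (a + star a) = \<Delta> a + star (\<Delta> a)\<close>, and \<open>\<Delta>\<close> is
  homogeneous because \<open>c *\<^sub>C a\<close> can be paired with \<open>a\<close>. For self-adjoint \<open>h\<close> and \<open>k\<close> put
  \<open>a = (h + \<i> *\<^sub>C k) / 2\<close>. Applied to \<open>a\<close>, \<open>- \<i> *\<^sub>C a\<close> and \<open>(1 - \<i>) *\<^sub>C a\<close>, the displayed identity
  expresses \<open>\<Delta> h\<close>, \<open>\<Delta> k\<close> and \<open>\<Delta> (h + k)\<close> through \<open>\<Delta> a\<close> and \<open>star (\<Delta> a)\<close>, and additivity
  can be read off.

  The Hahn--Banach theorem is obtained from Zorn's lemma by showing that a minimal sublinear
  functional is linear.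
\<close>

section \<open>Sublinear functionals\<close>

text \<open>Asking only for \<open>\<le>\<close>, and only at positive scalars, shortens the checks
  for infima; applying it to \<open>inverse c\<close> gives equality back in
  \<open>sublinear_scaleR\<close>.\<close>

definition sublinear :: "('a::real_vector \<Rightarrow> real) \<Rightarrow> bool"
  where "sublinear p \<longleftrightarrow>
    (\<forall>x y. p (x + y) \<le> p x + p y) \<and> (\<forall>c x. 0 < c \<longrightarrow> p (c *\<^sub>R x) \<le> c * p x)"

lemma sublinear_add: "sublinear p \<Longrightarrow> p (x + y) \<le> p x + p y"
  by (simp add: sublinear_def)

lemma sublinear_scaleR_le: "sublinear p \<Longrightarrow> 0 < c \<Longrightarrow> p (c *\<^sub>R x) \<le> c * p x"
  by (simp add: sublinear_def)

lemma sublinear_zero: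
  assumes "sublinear p"
  shows "p 0 = 0"
  using sublinear_scaleR_le[OF assms, of 2 0] sublinear_scaleR_le[OF assms, of "1/2" 0] by simp

lemma sublinear_scaleR:
  assumes p: "sublinear p" and c: "0 \<le> c"
  shows "p (c *\<^sub>R x) = c * p x"
proof (cases "c = 0")
  case True
  then show ?thesis by (simp add: sublinear_zero[OF p])
next
  case False
  with c have "0 < c" by simp
  moreover have "p x \<le> inverse c * p (c *\<^sub>R x)"
    using sublinear_scaleR_le[OF p, of "inverse c" "c *\<^sub>R x"] \<open>0 < c\<close> by simp
  ultimately show ?thesis
    using sublinear_scaleR_le[OF p, of c x] by (simp add: field_simps)
qed

lemma sublinear_neg_le: "sublinear p \<Longrightarrow> - p (- x) \<le> p x"
  using sublinear_add[of p x "- x"] sublinear_zero[of p] by simp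

lemma sublinear_norm: "sublinear norm"
  by (simp add: sublinear_def norm_triangle_ineq)

text \<open>
  \<open>tilt p y\<close> lies below \<open>p\<close> and takes a value at most \<open>- p y\<close> at \<open>- y\<close>, which forces any linear
  functional below it to agree with \<open>p\<close> at \<open>y\<close>.
\<close>

definition tilt :: "('a::real_vector \<Rightarrow> real) \<Rightarrow> 'a \<Rightarrow> 'a \<Rightarrow> real"
  where "tilt p y z = (INF t\<in>{0..}. p (z + t *\<^sub>R y) - t * p y)"

lemma tilt_le:
  assumes "sublinear p" "0 \<le> t"
  shows "tilt p y z \<le> p (z + t *\<^sub>R y) - t * p y"
  unfolding tilt_def
proof (rule cINF_lower)
  show "bdd_below ((\<lambda>t. p (z + t *\<^sub>R y) - t * p y) ` {0..})"
  proof (rule bdd_belowI2)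
    fix s :: real assume "s \<in> {0..}"
    \<comment> \<open>A bound independent of \<open>s\<close>, from
      \<open>s * p y = p ((z + s *\<^sub>R y) + (- z))\<close>.\<close>
    then show "- p (- z) \<le> p (z + s *\<^sub>R y) - s * p y"
      using sublinear_add[OF assms(1), of "z + s *\<^sub>R y" "- z"] sublinear_scaleR[OF assms(1), of s y]
      by simp
  qed
qed (use assms in simp)

lemma tilt_greatest: "(\<And>t. 0 \<le> t \<Longrightarrow> r \<le> p (z + t *\<^sub>R y) - t * p y) \<Longrightarrow> r \<le> tilt p y z"
  unfolding tilt_def by (rule cINF_greatest) auto

lemma tilt_le_self: "sublinear p \<Longrightarrow> tilt p y \<le> p"
  using tilt_le[of p 0] by (auto simp: le_fun_def)

lemma sublinear_tilt:
  assumes p: "sublinear p"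
  shows "sublinear (tilt p y)"
  unfolding sublinear_def
proof (intro conjI allI impI)
  fix u v
  \<comment> \<open>Parameters \<open>s\<close> for \<open>u\<close> and \<open>t\<close> for
    \<open>v\<close> combine to \<open>s + t\<close> for \<open>u + v\<close>; then the infimum is
    taken over \<open>t\<close> and over \<open>s\<close> in turn.\<close>
  have "tilt p y (u + v) - (p (u + s *\<^sub>R y) - s * p y) \<le> p (v + t *\<^sub>R y) - t * p y"
    if "0 \<le> s" "0 \<le> t" for s t
    using tilt_le[OF p, of "s + t" y "u + v"] that
      sublinear_add[OF p, of "u + s *\<^sub>R y" "v + t *\<^sub>R y"]
    by (simp add: algebra_simps)
  then have "tilt p y (u + v) - (p (u + s *\<^sub>R y) - s * p y) \<le> tilt p y v" if "0 \<le> s" for s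
    using that by (intro tilt_greatest) auto
  then have "tilt p y (u + v) - tilt p y v \<le> tilt p y u"
    by (intro tilt_greatest) (simp add: algebra_simps)
  then show "tilt p y (u + v) \<le> tilt p y u + tilt p y v" by simp
next
  fix c :: real and z assume c: "0 < c"
  have "tilt p y (c *\<^sub>R z) / c \<le> p (z + t *\<^sub>R y) - t * p y" if "0 \<le> t" for t
    using tilt_le[OF p, of "c * t" y "c *\<^sub>R z"] that c sublinear_scaleR[OF p, of c "z + t *\<^sub>R y"]
    by (simp add: field_simps scaleR_add_right)
  then have "tilt p y (c *\<^sub>R z) / c \<le> tilt p y z" by (rule tilt_greatest)
  then show "tilt p y (c *\<^sub>R z) \<le> c * tilt p y z" using c by (simp add: field_simps)
qed

text \<open>Minimality forces \<open>tilt p y = p\<close> for every \<open>y\<close>, and the bound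
  on \<open>tilt\<close> at \<open>t = 1\<close> is then superadditivity.\<close>

lemma minimal_sublinear_imp_linear:
  assumes p: "sublinear p" and minimal: "\<And>q. sublinear q \<Longrightarrow> q \<le> p \<Longrightarrow> q = p"
  shows "linear p"
proof -
  have add: "p (z + y) = p z + p y" for y z
  proof (rule antisym)
    have "tilt p y = p" by (intro minimal sublinear_tilt tilt_le_self p)
    then show "p z + p y \<le> p (z + y)" using tilt_le[OF p, of 1 y z] by simp
  qed (rule sublinear_add[OF p])
  have neg: "p (- x) = - p x" for x
    using add[of x "- x"] sublinear_zero[OF p] by simp
  have "p (c *\<^sub>R x) = c * p x" for c x
  proof (cases "0 \<le> c")
    case False
    then show ?thesis using sublinear_scaleR[OF p, of "- c" x] neg[of "c *\<^sub>R x"] by simp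
  qed (rule sublinear_scaleR[OF p])
  with add show ?thesis by (intro linearI) auto
qed

lemma exists_linear_le_sublinear:
  assumes p: "sublinear (p :: 'a::real_vector \<Rightarrow> real)"
  obtains f where "linear f" "f \<le> p"
proof -
  define A where "A = {q. sublinear q \<and> q \<le> p}"
  \<comment> \<open>The order is reversed, so an upper bound of a chain is a lower bound of
    functionals: \<open>p\<close> for the empty chain, otherwise the pointwise infimum.\<close>
  have "\<exists>m\<in>A. \<forall>q\<in>A. q \<le> m \<longrightarrow> q = m"
  proof (rule predicate_Zorn)
    show "partial_order_on A (relation_of (\<lambda>x y. y \<le> x) A)"
      by (rule partial_order_on_relation_ofI) auto
  next
    fix C assume "C \<in> Chains (relation_of (\<lambda>x y. y \<le> x) A)"
    then have C: "C \<subseteq> A" "\<And>q r. q \<in> C \<Longrightarrow> r \<in> C \<Longrightarrow> q \<le> r \<or> r \<le> q"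
      by (auto simp: Chains_def relation_of_def)
    show "\<exists>u\<in>A. \<forall>a\<in>C. u \<le> a"
    proof (cases "C = {}")
      case True
      then show ?thesis using p by (auto simp: A_def)
    next
      case False
      define u where "u x = (INF q\<in>C. q x)" for x
      have u_le: "u x \<le> q x" if "q \<in> C" for q x
        unfolding u_def
      proof (rule cINF_lower)
        show "bdd_below ((\<lambda>q. q x) ` C)"
        proof (rule bdd_belowI2)
          fix r assume "r \<in> C"
          then have "sublinear r" "r (- x) \<le> p (- x)"
            using C(1) by (auto simp: A_def le_fun_def)
          then show "- p (- x) \<le> r x" using sublinear_neg_le[of r x] by simp
        qed
      qed (rule that)
      have u_greatest: "b \<le> u x" if "\<And>q. q \<in> C \<Longrightarrow> b \<le> q x" for b x
        unfolding u_def using False that by (rule cINF_greatest)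
      have "sublinear u"
        unfolding sublinear_def
      proof (intro conjI allI impI)
        fix x y
        have "u (x + y) - q x \<le> r y" if qr: "q \<in> C" "r \<in> C" for q r
        proof -
          \<comment> \<open>In a chain, \<open>s\<close> can be the smaller of \<open>q\<close> and
            \<open>r\<close>.\<close>
          obtain s where "s \<in> C" "s \<le> q" "s \<le> r" using C(2)[OF qr] qr by blast
          moreover have "sublinear s" using \<open>s \<in> C\<close> C(1) by (auto simp: A_def)
          ultimately show ?thesis
            using u_le[of s "x + y"] sublinear_add[of s x y] le_funD[of s q x] le_funD[of s r y]
            by simp
        qed
        then have "u (x + y) - q x \<le> u y" if "q \<in> C" for q
          using that by (blast intro: u_greatest)
        then have "u (x + y) - u y \<le> u x"
          by (intro u_greatest) (simp add: algebra_simps)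
        then show "u (x + y) \<le> u x + u y" by simp
      next
        fix c :: real and x assume c: "0 < c"
        have "u (c *\<^sub>R x) / c \<le> q x" if "q \<in> C" for q
          using that C(1) c u_le[OF that, of "c *\<^sub>R x"] sublinear_scaleR_le[of q c x]
          by (force simp: A_def field_simps)
        then have "u (c *\<^sub>R x) / c \<le> u x" by (rule u_greatest)
        then show "u (c *\<^sub>R x) \<le> c * u x" using c by (simp add: field_simps)
      qed
      moreover obtain q where "q \<in> C" using False by blast
      then have "u \<le> q" "q \<le> p" using u_le C(1) by (auto simp: A_def le_fun_def)
      then have "u \<le> p" by (rule order_trans)
      ultimately show ?thesis using u_le by (auto simp: A_def le_fun_def)
    qed
  qed
  then obtain m where m: "m \<in> A" "\<And>q. q \<in> A \<Longrightarrow> q \<le> m \<Longrightarrow> q = m" by blast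
  have "linear m"
  proof (rule minimal_sublinear_imp_linear)
    fix q assume "sublinear q" "q \<le> m"
    moreover have "m \<le> p" using m(1) by (simp add: A_def)
    ultimately show "q = m" using m(2) by (auto simp: A_def intro: order_trans)
  qed (use m(1) in \<open>simp add: A_def\<close>)
  then show thesis using m(1) that by (auto simp: A_def)
qed

lemma norming_functional:
  fixes x :: "'a::real_normed_vector"
  obtains f :: "'a \<Rightarrow> real" where "bounded_linear f" "f x = norm x" "\<And>y. \<bar>f y\<bar> \<le> norm y"
proof -
  obtain f where f: "linear f" "f \<le> tilt norm x"
    using exists_linear_le_sublinear sublinear_tilt[OF sublinear_norm] by blast
  interpret linear f by (rule f)
  have le: "f y \<le> norm y" for y
    using f(2) tilt_le_self[OF sublinear_norm, of x] by (metis le_funD order_trans)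
  have abs: "\<bar>f y\<bar> \<le> norm y" for y
    using le[of y] le[of "- y"] by (simp add: neg abs_le_iff)
  have "f (- x) \<le> tilt norm x (- x)" using f(2) by (rule le_funD)
  also have "\<dots> \<le> - norm x" using tilt_le[OF sublinear_norm, of 1 x "- x"] by simp
  finally have "f x = norm x" using le[of x] by (simp add: neg)
  moreover have "bounded_linear f"
    by (rule bounded_linear_intro[where K = 1]) (use abs in \<open>simp_all add: add scale\<close>)
  ultimately show thesis using abs that by blast
qed

section \<open>Functionals on complex Banach spaces and C*-algebras\<close>

interpretation scaleC: vector_space "scaleC :: complex \<Rightarrow> 'a::complex_banach \<Rightarrow> 'a"
  by (rule vector_space_scaleC)

lemma clinear_add: "clinear f \<Longrightarrow> f (x + y) = f x + f y"
  by (simp add: clinear_iff)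

lemma clinear_scaleC: "clinear f \<Longrightarrow> f (c *\<^sub>C x) = c *\<^sub>C f x"
  by (simp add: clinear_iff)

lemma dual_clinear: "\<phi> \<in> dual \<Longrightarrow> clinear \<phi>"
  by (simp add: dual_def)

lemma dualI:
  assumes add: "\<And>x y. \<phi> (x + y) = \<phi> x + \<phi> y" and scale: "\<And>c x. \<phi> (c *\<^sub>C x) = c * \<phi> x"
    and bound: "\<And>x. cmod (\<phi> x) \<le> norm x * K"
  shows "\<phi> \<in> dual"
proof -
  have "\<phi> (r *\<^sub>R x) = r *\<^sub>R \<phi> x" for r x
    using scale[of "of_real r" x] by (simp add: scaleC_of_real scaleR_conv_of_real)
  then have "bounded_linear \<phi>" using add bound by (intro bounded_linear_intro)
  then show ?thesis using add scale by (simp add: dual_def clinear_iff) (simp add: scaleC_complex_def)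
qed

lemma dual_bound:
  assumes "\<phi> \<in> dual"
  obtains K where "\<And>x. cmod (\<phi> x) \<le> norm x * K"
  using assms bounded_linear.bounded unfolding dual_def by blast

lemma scaleC_scaleR_commute: "c *\<^sub>C r *\<^sub>R (x::'a::complex_banach) = r *\<^sub>R c *\<^sub>C x"
  by (simp add: scaleC_scaleC mult.commute flip: scaleC_of_real)

text \<open>The standard passage from a real functional to the complex one with real part
  \<open>f\<close>. The constant 2 comes from bounding the modulus by the sum of the absolute values
  of both parts.\<close>

lemma complexify_in_dual:
  fixes f :: "'b::complex_banach \<Rightarrow> real"
  assumes "bounded_linear f" and bound: "\<And>y. \<bar>f y\<bar> \<le> norm y"
  shows "(\<lambda>y. Complex (f y) (- f (\<i> *\<^sub>C y))) \<in> dual"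
proof (rule dualI[where K = 2])
  interpret bounded_linear f by (rule assms)
  show "Complex (f (y + z)) (- f (\<i> *\<^sub>C (y + z)))
      = Complex (f y) (- f (\<i> *\<^sub>C y)) + Complex (f z) (- f (\<i> *\<^sub>C z))" for y z
    by (simp add: add scaleC_add_right complex_eq_iff)
  show "Complex (f (c *\<^sub>C y)) (- f (\<i> *\<^sub>C c *\<^sub>C y)) = c * Complex (f y) (- f (\<i> *\<^sub>C y))" for c y
  proof -
    have cy: "c *\<^sub>C y = Re c *\<^sub>R y + Im c *\<^sub>R \<i> *\<^sub>C y"
      by (simp add: scaleC_scaleC complex_eq_iff flip: scaleC_of_real scaleC_add_left)
    have icy: "\<i> *\<^sub>C c *\<^sub>C y = Re c *\<^sub>R \<i> *\<^sub>C y - Im c *\<^sub>R y"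
      unfolding cy using scaleC_of_real[of "- 1" y]
      by (simp add: scaleC_add_right scaleC_scaleR_commute scaleC_scaleC)
    have "f (\<i> *\<^sub>C c *\<^sub>C y) = Re c * f (\<i> *\<^sub>C y) - Im c * f y"
      unfolding icy by (simp add: diff scaleR)
    moreover have "f (c *\<^sub>C y) = Re c * f y + Im c * f (\<i> *\<^sub>C y)"
      unfolding cy by (simp add: add scaleR)
    ultimately show ?thesis by (simp add: complex_eq_iff)
  qed
  show "cmod (Complex (f y) (- f (\<i> *\<^sub>C y))) \<le> norm y * 2" for y
    using cmod_le[of "Complex (f y) (- f (\<i> *\<^sub>C y))"] bound[of y] bound[of "\<i> *\<^sub>C y"]
    by (simp add: norm_scaleC)
qed

lemma dual_separates:
  fixes x y :: "'b::complex_banach"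
  assumes "\<And>\<phi>. \<phi> \<in> dual \<Longrightarrow> \<phi> x = \<phi> y"
  shows "x = y"
proof -
  obtain f where f: "bounded_linear f" "f (x - y) = norm (x - y)" "\<And>z. \<bar>f z\<bar> \<le> norm z"
    using norming_functional[of "x - y"] by blast
  from assms[OF complexify_in_dual[OF f(1,3)]] have "f x = f y" by simp
  then have "f (x - y) = 0" using f(1) by (simp add: linear_simps)
  then show ?thesis using f(2) by simp
qed

section \<open>The involution and hermitian functionals\<close>

lemma star_zero [simp]: "star (0::'a::cstar_algebra) = 0"
  using star_add[of "0::'a" 0] by simp

lemma norm_le_norm_star: "norm x \<le> norm (star x)" for x :: "'a::cstar_algebra"
proof (cases "x = 0")
  case False
  have "norm x * norm x \<le> norm (star x) * norm x"
    using norm_mult_ineq[of "star x" x] by (simp add: norm_star_mult_self power2_eq_square)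
  with False show ?thesis by simp
qed simp

lemma norm_star [simp]: "norm (star x) = norm x" for x :: "'a::cstar_algebra"
  using norm_le_norm_star[of x] norm_le_norm_star[of "star x"] by (simp add: star_star)

definition hermitian :: "('b::cstar_algebra \<Rightarrow> complex) \<Rightarrow> bool"
  where "hermitian \<phi> \<longleftrightarrow> (\<forall>x. \<phi> (star x) = cnj (\<phi> x))"

text \<open>
  Any \<open>\<phi>\<close> is recovered from the hermitian functionals \<open>\<phi> + \<phi>'\<close> and \<open>\<i> (\<phi> - \<phi>')\<close>, where
  \<open>\<phi>' x = cnj (\<phi> (star x))\<close>.
\<close>

lemma hermitian_part_in_dual:
  assumes "\<phi> \<in> dual"
  shows "(\<lambda>x. c * \<phi> x + cnj (c * \<phi> (star x))) \<in> dual"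
    and "hermitian (\<lambda>x. c * \<phi> x + cnj (c * \<phi> (star x)))"
proof -
  note lin = dual_clinear[OF assms]
  obtain K where K: "\<And>x. cmod (\<phi> x) \<le> norm x * K" using dual_bound[OF assms] by blast
  show "(\<lambda>x. c * \<phi> x + cnj (c * \<phi> (star x))) \<in> dual"
  proof (rule dualI[where K = "2 * cmod c * K"])
    fix x
    have "cmod (c * \<phi> x + cnj (c * \<phi> (star x))) \<le> cmod c * cmod (\<phi> x) + cmod c * cmod (\<phi> (star x))"
      using norm_triangle_ineq[of "c * \<phi> x" "cnj (c * \<phi> (star x))"] by (simp add: norm_mult)
    also have "\<dots> \<le> cmod c * (norm x * K) + cmod c * (norm x * K)"
      using K[of x] K[of "star x"] by (intro add_mono mult_left_mono) auto
    finally show "cmod (c * \<phi> x + cnj (c * \<phi> (star x))) \<le> norm x * (2 * cmod c * K)"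
      by (simp add: algebra_simps)
  qed (simp_all add: clinear_add[OF lin] clinear_scaleC[OF lin] star_add star_scaleC
      scaleC_complex_def algebra_simps)
  show "hermitian (\<lambda>x. c * \<phi> x + cnj (c * \<phi> (star x)))"
    by (simp add: hermitian_def star_star add.commute)
qed

lemma hermitian_dual_separates:
  fixes x y :: "'b::cstar_algebra"
  assumes "\<And>\<phi>. \<phi> \<in> dual \<Longrightarrow> hermitian \<phi> \<Longrightarrow> \<phi> x = \<phi> y"
  shows "x = y"
proof (rule dual_separates)
  fix \<phi> :: "'b \<Rightarrow> complex" assume \<phi>: "\<phi> \<in> dual"
  have "c * \<phi> x + cnj (c * \<phi> (star x)) = c * \<phi> y + cnj (c * \<phi> (star y))" for c
    using assms[OF hermitian_part_in_dual[OF \<phi>, of c]] .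
  from this[of 1] this[of \<i>] show "\<phi> x = \<phi> y"
    by (simp add: complex_eq_iff)
qed

lemma cartesian_decomposition:
  fixes x :: "'a::cstar_algebra"
  obtains h k where "star h = h" "star k = k" "x = h + \<i> *\<^sub>C k"
proof
  show "star ((1/2) *\<^sub>C (x + star x)) = (1/2) *\<^sub>C (x + star x)"
    by (simp add: star_scaleC star_add star_star add.commute)
  \<comment> \<open>This is the imaginary part \<open>(x - star x) / (2 \<i>)\<close>, with the
    minus sign as a scalar so that \<open>star_scaleC\<close> applies.\<close>
  show "star ((\<i>/2) *\<^sub>C (star x + (- 1) *\<^sub>C x)) = (\<i>/2) *\<^sub>C (star x + (- 1) *\<^sub>C x)"
    by (simp add: star_scaleC star_add star_star scaleC.scale_right_distrib scaleC_scaleC add.commute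
        del: scaleC.scale_minus_left)
  show "x = (1/2) *\<^sub>C (x + star x) + \<i> *\<^sub>C (\<i>/2) *\<^sub>C (star x + (- 1) *\<^sub>C x)"
    by (simp add: scaleC.scale_right_distrib scaleC.scale_right_diff_distrib
        flip: scaleC.scale_left_distrib)
qed

section \<open>Weak-2-local symmetric maps\<close>

lemma weak_2_local_symmetricE:
  assumes "weak_2_local_symmetric \<Delta>" "\<phi> \<in> dual"
  obtains T where "clinear T" "symmetric_map T" "\<phi> (\<Delta> a) = \<phi> (T a)" "\<phi> (\<Delta> b) = \<phi> (T b)"
  using assms unfolding weak_2_local_symmetric_def by blast

lemma weak_2_local_symmetric_scaleC:
  assumes "weak_2_local_symmetric \<Delta>"
  shows "\<Delta> (c *\<^sub>C a) = c *\<^sub>C \<Delta> a"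
proof (rule dual_separates)
  fix \<phi> :: "'b \<Rightarrow> complex" assume \<phi>: "\<phi> \<in> dual"
  then obtain T where "clinear T" "\<phi> (\<Delta> (c *\<^sub>C a)) = \<phi> (T (c *\<^sub>C a))" "\<phi> (\<Delta> a) = \<phi> (T a)"
    using weak_2_local_symmetricE[OF assms \<phi>] by metis
  then show "\<phi> (\<Delta> (c *\<^sub>C a)) = \<phi> (c *\<^sub>C \<Delta> a)"
    by (simp add: clinear_scaleC dual_clinear[OF \<phi>])
qed

text \<open>\<open>T\<close> is tied to \<open>\<Delta>\<close> at \<open>a\<close> only through
  \<open>\<phi>\<close>. Hermitian \<open>\<phi>\<close> carries this over to the adjoint:
  \<open>\<phi> (T (star a)) = cnj (\<phi> (T a)) = cnj (\<phi> (\<Delta> a)) = \<phi> (star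
  (\<Delta> a))\<close>.\<close>

lemma weak_2_local_symmetric_add_star:
  assumes "weak_2_local_symmetric \<Delta>"
  shows "\<Delta> (a + star a) = \<Delta> a + star (\<Delta> a)"
proof (rule hermitian_dual_separates)
  fix \<phi> :: "'b \<Rightarrow> complex" assume \<phi>: "\<phi> \<in> dual" "hermitian \<phi>"
  obtain T where "clinear T" "symmetric_map T"
    "\<phi> (\<Delta> (a + star a)) = \<phi> (T (a + star a))" "\<phi> (\<Delta> a) = \<phi> (T a)"
    using weak_2_local_symmetricE[OF assms \<phi>(1)] by metis
  then show "\<phi> (\<Delta> (a + star a)) = \<phi> (\<Delta> a + star (\<Delta> a))"
    using \<phi>(2) by (simp add: clinear_add dual_clinear[OF \<phi>(1)] symmetric_map_def hermitian_def)
qed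

theorem theorem2p5:
  fixes \<Delta> :: "'a::cstar_algebra \<Rightarrow> 'b::cstar_algebra"
  assumes "weak_2_local_symmetric \<Delta>"
  shows "clinear \<Delta>"
proof -
  note scale = weak_2_local_symmetric_scaleC[OF assms]
  have twist: "\<Delta> (c *\<^sub>C a + cnj c *\<^sub>C star a) = c *\<^sub>C \<Delta> a + cnj c *\<^sub>C star (\<Delta> a)" for c a
    using weak_2_local_symmetric_add_star[OF assms, of "c *\<^sub>C a"] by (simp add: scale star_scaleC)
  have sa: "\<Delta> (h + k) = \<Delta> h + \<Delta> k" "\<Delta> (h + \<i> *\<^sub>C k) = \<Delta> h + \<i> *\<^sub>C \<Delta> k"
    if "star h = h" "star k = k" for h k
  proof -
    define a where "a = (1/2) *\<^sub>C (h + \<i> *\<^sub>C k)"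
    \<comment> \<open>The left side is the self-adjoint part of
      \<open>c *\<^sub>C (h + \<i> *\<^sub>C k)\<close>. Taking \<open>c\<close> to be
      \<open>1\<close>, \<open>- \<i>\<close> and \<open>1 - \<i>\<close> below yields
      \<open>h\<close>, \<open>k\<close> and \<open>h + k\<close>.\<close>
    have comb: "c *\<^sub>C a + cnj c *\<^sub>C star a = of_real (Re c) *\<^sub>C h + of_real (- Im c) *\<^sub>C k" for c
    proof -
      have "c *\<^sub>C a + cnj c *\<^sub>C star a
          = (c / 2 + cnj c / 2) *\<^sub>C h + (c / 2 * \<i> + cnj c / 2 * (- \<i>)) *\<^sub>C k"
        unfolding a_def star_scaleC star_add that scaleC_add_right scaleC_add_left scaleC_scaleC
        by simp
      moreover have "c / 2 + cnj c / 2 = of_real (Re c)"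
        "c / 2 * \<i> + cnj c / 2 * (- \<i>) = of_real (- Im c)"
        by (simp_all add: complex_eq_iff)
      ultimately show ?thesis by simp
    qed
    have h: "\<Delta> h = \<Delta> a + star (\<Delta> a)"
      using twist[of 1 a] comb[of 1] by simp
    have k: "\<Delta> k = (- \<i>) *\<^sub>C \<Delta> a + \<i> *\<^sub>C star (\<Delta> a)"
      using twist[of "- \<i>" a] comb[of "- \<i>"] by simp
    have "\<Delta> (h + k) = (1 - \<i>) *\<^sub>C \<Delta> a + (1 + \<i>) *\<^sub>C star (\<Delta> a)"
      using twist[of "1 - \<i>" a] comb[of "1 - \<i>"] by simp
    then show "\<Delta> (h + k) = \<Delta> h + \<Delta> k"
      by (simp add: h k scaleC.scale_left_distrib scaleC.scale_left_diff_distrib)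
    \<comment> \<open>In \<open>\<Delta> h + \<i> *\<^sub>C \<Delta> k\<close> the two
      \<open>star (\<Delta> a)\<close> terms cancel, leaving twice
      \<open>\<Delta> a\<close>.\<close>
    have "h + \<i> *\<^sub>C k = 2 *\<^sub>C a"
      by (simp add: a_def)
    then have "\<Delta> (h + \<i> *\<^sub>C k) = 2 *\<^sub>C \<Delta> a"
      by (simp add: scale)
    also have "\<dots> = \<Delta> h + \<i> *\<^sub>C \<Delta> k"
      using scaleC.scale_left_distrib[of 1 1 "\<Delta> a"]
      by (simp add: h k scaleC.scale_right_diff_distrib scaleC.scale_right_distrib)
    finally show "\<Delta> (h + \<i> *\<^sub>C k) = \<Delta> h + \<i> *\<^sub>C \<Delta> k" .
  qed
  \<comment> \<open>Splitting into self-adjoint parts reduces general additivity to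
    \<open>sa\<close>: its second identity separates the parts, its first adds them.\<close>
  have "\<Delta> (x + y) = \<Delta> x + \<Delta> y" for x y
  proof -
    obtain h k where x: "star h = h" "star k = k" "x = h + \<i> *\<^sub>C k"
      by (rule cartesian_decomposition)
    obtain h' k' where y: "star h' = h'" "star k' = k'" "y = h' + \<i> *\<^sub>C k'"
      by (rule cartesian_decomposition)
    have "\<Delta> (x + y) = \<Delta> ((h + h') + \<i> *\<^sub>C (k + k'))"
      using x(3) y(3) by (simp add: scaleC_add_right algebra_simps)
    also have "\<dots> = \<Delta> (h + h') + \<i> *\<^sub>C \<Delta> (k + k')"
      using x y by (intro sa(2)) (simp_all add: star_add)
    also have "\<dots> = (\<Delta> h + \<i> *\<^sub>C \<Delta> k) + (\<Delta> h' + \<i> *\<^sub>C \<Delta> k')"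
      using x y by (simp add: sa(1) scaleC_add_right)
    also have "\<dots> = \<Delta> x + \<Delta> y"
      using x y by (simp add: sa(2))
    finally show ?thesis .
  qed
  then show ?thesis using scale by (simp add: clinear_iff)
qed

end
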